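(* Let $q\ge 4$ be an integer and let $\beta>0$ be real. If $p=p(n)\in[0,1]$ satisfies $p\ge n^{-\frac{1}{q+0.5}+\beta}$, then asymptotically almost surely the binomial random graph $G(n,p)$ has a fractional $K_q$-decomposition.
   Context: $G(n,p)$ is the random graph on vertex set $[n]$ in which each possible edge is included independently with probability $p$. "Asymptotically almost surely" means with probability tending to $1$ as $n\to\infty$. A fractional $K_q$-decomposition of a graph $G$ is a function $\psi$ from the set of $q$-cliques of $G$ to $\mathbb R_{\ge0}$ such that for every edge $e$ of $G$ the sum of $\psi(Q)$ over all $q$-cliques $Q$ of $G$ containing $e$ equals $1$. *)

theory Defs
  imports "HOL-Probability.Probability" "HOL-Library.Ramsey"
begin

text \<open>
  A simple graph on a vertex set \<open>V\<close> is given by \<open>V\<close> together with its edge set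
  \<open>E \<subseteq> [V]\<^bsup>2\<^esup>\<close>, where \<open>[V]\<^bsup>k\<^esup>\<close> is the set of
  \<open>k\<close>-element subsets of \<open>V\<close>. The vertex set of \<open>G(n,p)\<close> is \<open>{1..n}\<close>.
\<close>

text \<open>
  \<open>G(n,p)\<close> as a distribution on edge sets: one independent \<open>p\<close>-biased coin for every
  potential edge. (\<open>bernoulli_pmf\<close> truncates its argument to \<open>[0,1]\<close>, so this is
  meaningful only for \<open>0 \<le> p \<le> 1\<close>.)
\<close>
definition gnp :: "nat \<Rightarrow> real \<Rightarrow> nat set set pmf" where
  "gnp n p =
     map_pmf (\<lambda>f. {e \<in> [{1..n}]\<^bsup>2\<^esup>. f e})
       (Pi_pmf ([{1..n}]\<^bsup>2\<^esup>) False (\<lambda>_. bernoulli_pmf p))"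

definition cliques :: "nat \<Rightarrow> 'a set \<Rightarrow> 'a set set \<Rightarrow> 'a set set" where
  "cliques q V E = {Q \<in> [V]\<^bsup>q\<^esup>. clique Q E}"

text \<open>
  A clique is represented by its vertex set, so for \<open>e \<in> E\<close> the cliques containing the
  edge \<open>e\<close> are the \<open>Q\<close> with \<open>e \<subseteq> Q\<close>. Values of \<open>\<psi>\<close> outside
  \<open>cliques q V E\<close> are irrelevant. The definition is intended for finite \<open>V\<close>.
\<close>
definition fractional_clique_decomposition ::
    "nat \<Rightarrow> 'a set \<Rightarrow> 'a set set \<Rightarrow> ('a set \<Rightarrow> real) \<Rightarrow> bool" where
  "fractional_clique_decomposition q V E \<psi> \<longleftrightarrow>
     (\<forall>Q \<in> cliques q V E. 0 \<le> \<psi> Q) \<and>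
     (\<forall>e \<in> E. (\<Sum>Q \<in> {Q \<in> cliques q V E. e \<subseteq> Q}. \<psi> Q) = 1)"

end

theory Submission
  imports Defs "HOL-Real_Asymp.Real_Asymp"
begin

text \<open>
  Give every \<open>q\<close>-clique the same weight \<open>1/D\<close>, where \<open>D\<close> is close to the expected
  number of \<open>q\<close>-cliques on an edge. Since these numbers are concentrated, each edge receives total weight close
  to \<open>1\<close>, and the small errors are corrected locally. Inside a \<open>(q+2)\<close>-clique \<open>H\<close> with an
  edge \<open>e\<close> there is a signed weighting of the \<open>q\<close>-subsets of \<open>H\<close> that adds \<open>1\<close> to \<open>e\<close> and
  \<open>0\<close> to every other edge (\<open>gadget_weight_sum\<close>). The error at \<open>e\<close> is spread evenly over all
  \<open>(q+2)\<close>-cliques on \<open>e\<close>. This corrects all edges exactly, and the weights remain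
  nonnegative as long as no \<open>q\<close>-clique lies in too many \<open>(q+2)\<close>-cliques in proportion to the
  number of \<open>(q+2)\<close>-cliques on an edge (\<open>fractional_clique_decomposition_of_regularity\<close>).

  All these clique numbers are controlled by two kinds of quantities, counted by adding vertices to
  a clique: the number of common neighbours of a set of \<open>i \<le> q\<close> vertices, which
  should be about \<open>n p\<^sup>i\<close>, and the number of edges inside the common neighbourhood of a set of
  \<open>q\<close> vertices, which should have order \<open>n\<^sup>2 p\<^bsup>2q+1\<^esup>\<close>. The last one is where the exponent
  \<open>1/(q+1/2)\<close> comes from: \<open>n p\<^bsup>q+1/2\<^esup>\<close> has to be a positive power of \<open>n\<close>. Adding the last two
  vertices of a \<open>(q+2)\<close>-clique together, as an edge, matters, because in this range \<open>q + 1\<close>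
  vertices need not have any common neighbour. Relative precision is needed only for the common
  neighbourhoods; for the pairs of last vertices constant factors suffice, and they are compensated
  by the precision of the former.

  Both estimates follow from a Chernoff bound for the number of blocks showing only heads in a family of
  disjoint blocks of independent coins. For the edges inside a common neighbourhood
  one conditions on this neighbourhood, which is determined by other edges. The error
  probabilities are exponentially small in \<open>n powr \<beta>\<close>, so that a union bound over the at most
  \<open>(q+1) n\<^sup>q\<close> vertex sets finishes the proof.
\<close>

section \<open>Gadgets in cliques with two more vertices\<close>

lemma card_nsets:
  assumes "finite A"
  shows "card ([A]\<^bsup>k\<^esup>) = card A choose k"
proof -
  have "[A]\<^bsup>k\<^esup> = {B. B \<subseteq> A \<and> card B = k}"
    using assms by (auto simp: nsets_def finite_subset)
  then show ?thesis using n_subsets[OF assms] by simp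
qed

text \<open>
  A \<open>q\<close>-subset of \<open>H\<close> is the complement of a pair, and it contains \<open>T\<close> iff the pair avoids \<open>T\<close>.
  This also covers \<open>card T > q\<close>, where both sides vanish.
\<close>
lemma card_nsets_containing:
  assumes "finite H" "card H = q + 2" "T \<subseteq> H"
  shows "card {Q \<in> [H]\<^bsup>q\<^esup>. T \<subseteq> Q} = (q + 2 - card T) choose 2"
proof -
  have [simp]: "card (H - P) = card H - card P" if "P \<subseteq> H - T" for P
    using that assms by (metis Diff_subset card_Diff_subset finite_subset subset_trans)
  have "bij_betw (\<lambda>Q. H - Q) {Q \<in> [H]\<^bsup>q\<^esup>. T \<subseteq> Q} ([H - T]\<^bsup>2\<^esup>)"
    using assms
    by (intro bij_betwI[where g = "\<lambda>P. H - P"])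
       (auto simp: nsets_def card_Diff_subset finite_subset[OF _ assms(1)])
  then have "card {Q \<in> [H]\<^bsup>q\<^esup>. T \<subseteq> Q} = card ([H - T]\<^bsup>2\<^esup>)"
    by (rule bij_betw_same_card)
  also have "\<dots> = card (H - T) choose 2"
    using assms by (intro card_nsets) auto
  finally show ?thesis
    using assms by (simp add: card_Diff_subset finite_subset)
qed

text \<open>
  By symmetry the weight may only depend on \<open>card (Q \<inter> e)\<close>. The requirements at \<open>e\<close>, at the edges
  meeting \<open>e\<close> in one vertex and at the edges disjoint from \<open>e\<close> are three linear equations for the
  three possible values, and these determine the weight. The solution is written as a combination of
  indicators of \<open>T \<subseteq> Q\<close> with \<open>T \<subseteq> e\<close>, each of which is easy to sum.
\<close>
definition gadget_weight :: "nat \<Rightarrow> 'a set \<Rightarrow> 'a set \<Rightarrow> real" where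
  "gadget_weight q e Q =
     (real q - 2) / real q - (real q - 2) / (real q - 1) * real (card (Q \<inter> e)) + (if e \<subseteq> Q then 1 else 0)"

text \<open>
  For \<open>card (Q \<inter> e) = 2, 1, 0\<close> the weight is \<open>2/(q(q-1))\<close>, \<open>-(q-2)/(q(q-1))\<close> and \<open>(q-2)/q\<close>.
\<close>
lemma abs_gadget_weight_le_1:
  assumes "q \<ge> 2" "card e = 2"
  shows "\<bar>gadget_weight q e Q\<bar> \<le> 1"
proof -
  have fin: "finite e" using assms by (metis card.infinite zero_neq_numeral)
  have le: "card (Q \<inter> e) \<le> 2" by (metis Int_lower2 card_mono fin assms(2))
  consider "e \<subseteq> Q" "card (Q \<inter> e) = 2" | "\<not> e \<subseteq> Q" "card (Q \<inter> e) = 1" | "\<not> e \<subseteq> Q" "card (Q \<inter> e) = 0"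
  proof (cases "e \<subseteq> Q")
    case True
    then have "Q \<inter> e = e" by auto
    with True assms that show ?thesis by simp
  next
    case False
    then have "Q \<inter> e \<subset> e" by auto
    then have "card (Q \<inter> e) < 2" using psubset_card_mono[OF fin] assms by metis
    with False that show ?thesis by linarith
  qed
  then show ?thesis
  proof cases
    case 1
    then have "gadget_weight q e Q = 2 / (real q * (real q - 1))"
      using assms(1) by (simp add: gadget_weight_def field_simps)
    moreover have "2 * 1 \<le> real q * (real q - 1)" using assms(1) by (intro mult_mono) auto
    ultimately show ?thesis by simp
  next
    case 2
    then have "gadget_weight q e Q = - (real q - 2) / (real q * (real q - 1))"
      using assms(1) unfolding gadget_weight_def by (simp add: field_simps)
    moreover have "1 * (real q - 2) \<le> real q * (real q - 1)" using assms(1) by (intro mult_mono) auto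
    ultimately show ?thesis using assms(1) by (simp add: abs_divide)
  next
    case 3
    then have "gadget_weight q e Q = (real q - 2) / real q"
      unfolding gadget_weight_def by simp
    then show ?thesis using assms(1) by simp
  qed
qed

text \<open>
  The weight is a combination of the indicators of \<open>{} \<subseteq> Q\<close>, \<open>{x} \<subseteq> Q\<close>, \<open>{y} \<subseteq> Q\<close> and \<open>e \<subseteq> Q\<close> for
  \<open>e = {x, y}\<close>, and \<open>card_nsets_containing\<close> sums each of them over the sets \<open>Q\<close> containing \<open>f\<close>. It remains to
  compare binomial coefficients, depending on which of \<open>x\<close>, \<open>y\<close> belong to \<open>f\<close>.
\<close>
lemma gadget_weight_sum:
  assumes q: "q \<ge> 2" and H: "finite H" "card H = q + 2" and e: "e \<in> [H]\<^bsup>2\<^esup>" and f: "f \<in> [H]\<^bsup>2\<^esup>"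
  shows "(\<Sum>Q \<in> {Q \<in> [H]\<^bsup>q\<^esup>. f \<subseteq> Q}. gadget_weight q e Q) = (if e = f then 1 else 0)"
proof -
  let ?F = "{Q \<in> [H]\<^bsup>q\<^esup>. f \<subseteq> Q}"
  have finF: "finite ?F" using H by (simp add: finite_imp_finite_nsets)
  obtain x y where xy: "e = {x, y}" "x \<noteq> y" "x \<in> H" "y \<in> H"
    using e by (elim nsets2_E)
  have fH: "f \<subseteq> H" "card f = 2" "finite f" using f by (auto simp: nsets_def)
  have ind: "(\<Sum>Q\<in>?F. if T \<subseteq> Q then 1 else 0) = real ((q + 2 - card (f \<union> T)) choose 2)" if "T \<subseteq> H" for T
  proof -
    have "(\<Sum>Q\<in>?F. if T \<subseteq> Q then 1 else 0) = real (card {Q \<in> [H]\<^bsup>q\<^esup>. f \<union> T \<subseteq> Q})"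
      using finF by (simp add: sum.If_cases Int_def conj_assoc)
    then show ?thesis using card_nsets_containing[OF H, of "f \<union> T"] that fH by simp
  qed
  have split: "real (card (Q \<inter> e)) = (if {x} \<subseteq> Q then 1 else 0) + (if {y} \<subseteq> Q then 1 else 0)" for Q
    using xy by auto
  let ?a = "(real q - 2) / real q" and ?b = "(real q - 2) / (real q - 1)"
  let ?N = "\<lambda>T. \<Sum>Q\<in>?F. if T \<subseteq> Q then 1 else (0::real)"
  have "(\<Sum>Q\<in>?F. gadget_weight q e Q) = (\<Sum>Q\<in>?F. ?a * (if {} \<subseteq> Q then 1 else 0)
      - ?b * ((if {x} \<subseteq> Q then 1 else 0) + (if {y} \<subseteq> Q then 1 else 0)) + (if e \<subseteq> Q then 1 else 0))"
    unfolding gadget_weight_def split by simp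
  also have "\<dots> = ?a * ?N {} - ?b * (?N {x} + ?N {y}) + ?N e"
    by (simp only: sum.distrib sum_subtractf flip: sum_distrib_left)
  also have "\<dots> = ?a * real (q choose 2)
     - ?b * (real ((q + 2 - card (insert x f)) choose 2) + real ((q + 2 - card (insert y f)) choose 2))
     + real ((q + 2 - card (f \<union> e)) choose 2)"
    using ind[of "{}"] ind[of "{x}"] ind[of "{y}"] ind[of e] xy fH by simp
  also have "\<dots> = (if e = f then 1 else 0)"
  proof -
    have ch: "real (m choose 2) = real m * (real m - 1) / 2" for m :: nat
    proof -
      have "even (m * (m - 1))" by (cases m) auto
      then have "real (m choose 2) = real (m * (m - 1)) / 2"
        unfolding choose_two by (simp add: real_of_nat_div)
      then show ?thesis by (cases m) (auto simp: algebra_simps)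
    qed
    have card_e: "card e = 2" using xy by simp
    have e_eq: "e = f" if "x \<in> f" "y \<in> f"
      using that xy fH card_subset_eq[of f e] card_e by auto
    consider "x \<in> f" "y \<in> f" | "x \<in> f" "y \<notin> f" | "x \<notin> f" "y \<in> f" | "x \<notin> f" "y \<notin> f" by blast
    then show ?thesis
    proof cases
      case 1
      then have "e = f" using e_eq by blast
      moreover have "card (insert x f) = 2" "card (insert y f) = 2" using 1 fH by (auto simp: insert_absorb)
      ultimately show ?thesis using q fH by (simp add: ch field_simps)
    next
      case 2
      then have "card (f \<union> e) = 3" "card (insert x f) = 2" "card (insert y f) = 3"
        using fH xy by (auto simp: insert_absorb)
      then show ?thesis using q 2 xy by (auto simp: ch field_simps of_nat_diff)
    next
      case 3
      then have "card (f \<union> e) = 3" "card (insert x f) = 3" "card (insert y f) = 2"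
        using fH xy by (auto simp: insert_absorb)
      then show ?thesis using q 3 xy by (auto simp: ch field_simps of_nat_diff)
    next
      case 4
      then have "card (f \<union> e) = 4" "card (insert x f) = 3" "card (insert y f) = 3"
        using fH xy by auto
      moreover have "real ((q - 2) choose 2) = (real q - 2) * (real q - 3) / 2"
        using ch[of "q - 2"] q by (simp add: of_nat_diff)
      moreover have "real ((q - 1) choose 2) = (real q - 1) * (real q - 2) / 2"
        using ch[of "q - 1"] q by (simp add: of_nat_diff)
      ultimately show ?thesis using q 4 xy by (auto simp: ch field_simps of_nat_diff)
    qed
  qed
  finally show ?thesis .
qed

section \<open>From clique regularity to a fractional decomposition\<close>

definition clique_count :: "nat \<Rightarrow> 'a set \<Rightarrow> 'a set set \<Rightarrow> 'a set \<Rightarrow> nat" where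
  "clique_count k V E S = card {Q \<in> cliques k V E. S \<subseteq> Q}"

lemma finite_cliques: "finite V \<Longrightarrow> finite (cliques k V E)"
  by (simp add: cliques_def finite_imp_finite_nsets)

lemma clique_subset: "clique Q E \<Longrightarrow> S \<subseteq> Q \<Longrightarrow> clique S E"
  by (auto simp: clique_def)

lemma edge_in_cliques_2: "E \<subseteq> [V]\<^bsup>2\<^esup> \<Longrightarrow> e \<in> E \<Longrightarrow> e \<in> cliques 2 V E"
  by (auto simp: cliques_def clique_def nsets_def card_2_iff insert_commute)

lemma clique_pairs_are_edges: "Q \<in> cliques k V E \<Longrightarrow> [Q]\<^bsup>2\<^esup> \<subseteq> E"
  by (auto simp: cliques_def clique_def nsets_2_eq)

text \<open>
  The deficit \<open>d e\<close> that the uniform weight \<open>1/D\<close> leaves at \<open>e\<close> is split equally among the \<open>m e\<close> many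
  \<open>(q+2)\<close>-cliques \<open>H\<close> on \<open>e\<close>, and \<open>c H Q\<close> is the total correction of \<open>Q\<close> caused by the gadgets of
  \<open>H\<close>. On an edge \<open>f\<close> only the gadgets of \<open>f\<close> itself have an effect, so the correction is exact. A clique
  \<open>Q\<close> is corrected by at most \<open>h\<close> sets \<open>H\<close>, each having \<open>(q + 2) choose 2\<close> gadgets of size at most
  \<open>\<eta>/M\<close>; by the last hypothesis this is at most \<open>1/D\<close>.
\<close>
lemma fractional_clique_decomposition_of_regularity:
  fixes D M h \<eta> :: real
  assumes V: "finite V" and E: "E \<subseteq> [V]\<^bsup>2\<^esup>" and q: "q \<ge> 2"
    and pos: "D > 0" "M > 0" "h \<ge> 0" "\<eta> \<ge> 0"
    and reg: "\<And>e. e \<in> E \<Longrightarrow> \<bar>real (clique_count q V E e) - D\<bar> \<le> \<eta> * D"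
    and many: "\<And>e. e \<in> E \<Longrightarrow> real (clique_count (q + 2) V E e) \<ge> M"
    and few: "\<And>Q. Q \<in> cliques q V E \<Longrightarrow> real (clique_count (q + 2) V E Q) \<le> h"
    and small: "h * real ((q + 2) choose 2) * \<eta> * D \<le> M"
  shows "\<exists>\<psi>. fractional_clique_decomposition q V E \<psi>"
proof -
  let ?C = "cliques q V E" and ?G = "cliques (q + 2) V E"
  define d where "d e = 1 - real (clique_count q V E e) / D" for e
  define m where "m e = real (clique_count (q + 2) V E e)" for e
  define c where "c H Q = (\<Sum>e\<in>[H]\<^bsup>2\<^esup>. d e / m e * gadget_weight q e Q)" for H Q
  define \<psi> where "\<psi> Q = 1 / D + (\<Sum>H\<in>{H\<in>?G. Q \<subseteq> H}. c H Q)" for Q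
  have finC: "finite ?C" and finG: "finite ?G" using V by (auto intro: finite_cliques)
  have d_le: "\<bar>d e\<bar> \<le> \<eta>" if "e \<in> E" for e
  proof -
    have "d e = - (real (clique_count q V E e) - D) / D" using pos by (simp add: d_def field_simps)
    then have "\<bar>d e\<bar> = \<bar>real (clique_count q V E e) - D\<bar> / D" using pos by (simp add: abs_divide)
    then show ?thesis using reg[OF that] pos by (simp add: divide_le_eq)
  qed
  have c_le: "\<bar>c H Q\<bar> \<le> real ((q + 2) choose 2) * (\<eta> / M)" if H: "H \<in> ?G" for H Q
  proof -
    have "\<bar>c H Q\<bar> \<le> (\<Sum>e\<in>[H]\<^bsup>2\<^esup>. \<eta> / M)"
      unfolding c_def
    proof (rule order_trans[OF sum_abs sum_mono])
      fix e assume e: "e \<in> [H]\<^bsup>2\<^esup>"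
      then have eE: "e \<in> E" using clique_pairs_are_edges[OF H] by blast
      have "card e = 2" using e by (simp add: nsets_def)
      then have "\<bar>gadget_weight q e Q\<bar> \<le> 1" using q abs_gadget_weight_le_1 by blast
      moreover have "\<bar>d e / m e\<bar> \<le> \<eta> / M"
        using d_le[OF eE] many[OF eE] pos by (simp add: m_def abs_divide frac_le)
      ultimately show "\<bar>d e / m e * gadget_weight q e Q\<bar> \<le> \<eta> / M"
        using mult_mono[of "\<bar>d e / m e\<bar>" "\<eta> / M" "\<bar>gadget_weight q e Q\<bar>" 1] pos
        by (simp only: abs_mult) simp
    qed
    moreover have "card ([H]\<^bsup>2\<^esup>) = (q + 2) choose 2"
      using H card_nsets[of H 2] by (auto simp: cliques_def nsets_def)
    ultimately show ?thesis by simp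
  qed
  have "0 \<le> \<psi> Q" if Q: "Q \<in> ?C" for Q
  proof -
    have "\<bar>\<Sum>H\<in>{H\<in>?G. Q \<subseteq> H}. c H Q\<bar> \<le> (\<Sum>H\<in>{H\<in>?G. Q \<subseteq> H}. real ((q + 2) choose 2) * (\<eta> / M))"
      by (rule order_trans[OF sum_abs sum_mono]) (use c_le in auto)
    also have "\<dots> = real (clique_count (q + 2) V E Q) * (real ((q + 2) choose 2) * (\<eta> / M))"
      by (simp add: clique_count_def)
    also have "\<dots> \<le> h * (real ((q + 2) choose 2) * (\<eta> / M))"
      using few[OF Q] pos by (intro mult_right_mono) auto
    also have "\<dots> \<le> 1 / D" using small pos by (simp add: field_simps)
    finally show ?thesis by (simp add: \<psi>_def)
  qed
  moreover have "(\<Sum>Q\<in>{Q\<in>?C. f \<subseteq> Q}. \<psi> Q) = 1" if f: "f \<in> E" for f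
  proof -
    have f2: "card f = 2" using f E by (auto simp: nsets_def)
    have "(\<Sum>Q\<in>{Q\<in>?C. f \<subseteq> Q}. \<Sum>H\<in>{H\<in>?G. Q \<subseteq> H}. c H Q)
        = (\<Sum>H\<in>?G. \<Sum>Q\<in>{Q\<in>?C. f \<subseteq> Q \<and> Q \<subseteq> H}. c H Q)"
      using finC finG sum.swap_restrict[of "{Q\<in>?C. f \<subseteq> Q}" ?G "\<lambda>Q H. c H Q" "\<lambda>Q H. Q \<subseteq> H"]
      by (simp add: conj_assoc)
    also have "\<dots> = (\<Sum>H\<in>?G. if f \<subseteq> H then d f / m f else 0)"
    proof (rule sum.cong[OF refl])
      fix H assume H: "H \<in> ?G"
      then have H': "finite H" "card H = q + 2" "H \<subseteq> V" "clique H E" by (auto simp: cliques_def nsets_def)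
      show "(\<Sum>Q\<in>{Q\<in>?C. f \<subseteq> Q \<and> Q \<subseteq> H}. c H Q) = (if f \<subseteq> H then d f / m f else 0)"
      proof (cases "f \<subseteq> H")
        case False
        then have "{Q\<in>?C. f \<subseteq> Q \<and> Q \<subseteq> H} = {}" by auto
        with False show ?thesis by (simp only: sum.empty if_False)
      next
        case True
        have f_in: "f \<in> [H]\<^bsup>2\<^esup>" using True f2 H' by (auto simp: nsets_def finite_subset)
        have eq: "{Q\<in>?C. f \<subseteq> Q \<and> Q \<subseteq> H} = {Q\<in>[H]\<^bsup>q\<^esup>. f \<subseteq> Q}"
          using H' by (auto simp: cliques_def nsets_def finite_subset intro: clique_subset)
        have "(\<Sum>Q\<in>{Q\<in>[H]\<^bsup>q\<^esup>. f \<subseteq> Q}. c H Q)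
            = (\<Sum>e\<in>[H]\<^bsup>2\<^esup>. d e / m e * (\<Sum>Q\<in>{Q\<in>[H]\<^bsup>q\<^esup>. f \<subseteq> Q}. gadget_weight q e Q))"
          unfolding c_def by (subst sum.swap) (simp add: sum_distrib_left)
        also have "\<dots> = (\<Sum>e\<in>[H]\<^bsup>2\<^esup>. d e / m e * (if e = f then 1 else 0))"
          by (intro sum.cong refl) (simp add: gadget_weight_sum[OF q H'(1,2) _ f_in])
        also have "\<dots> = d f / m f"
          using f_in H' by (simp add: if_distrib sum.delta finite_imp_finite_nsets cong: if_cong)
        finally show ?thesis using True eq by simp
      qed
    qed
    also have "\<dots> = m f * (d f / m f)"
      using finG by (simp add: m_def clique_count_def sum.If_cases Int_def)
    also have "\<dots> = d f" using many[OF f] pos by (simp add: m_def)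
    finally have "(\<Sum>Q\<in>{Q\<in>?C. f \<subseteq> Q}. \<psi> Q) = real (clique_count q V E f) / D + d f"
      by (simp add: \<psi>_def sum.distrib clique_count_def)
    then show ?thesis by (simp add: d_def)
  qed
  ultimately show ?thesis
    unfolding fractional_clique_decomposition_def by blast
qed

section \<open>Counting cliques by adding vertices\<close>

definition common_nbrs :: "'a set \<Rightarrow> 'a set set \<Rightarrow> 'a set \<Rightarrow> 'a set" where
  "common_nbrs V E S = {v \<in> V. \<forall>u\<in>S. {u, v} \<in> E}"

lemma common_nbrs_disjoint: "E \<subseteq> [V]\<^bsup>2\<^esup> \<Longrightarrow> S \<noteq> {} \<Longrightarrow> v \<in> common_nbrs V E S \<Longrightarrow> v \<notin> S"
  by (fastforce simp: common_nbrs_def nsets_def)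

lemma insert_common_nbr_in_cliques:
  assumes "E \<subseteq> [V]\<^bsup>2\<^esup>" "S \<in> cliques s V E" "S \<noteq> {}" "v \<in> common_nbrs V E S"
  shows "insert v S \<in> cliques (Suc s) V E"
  using common_nbrs_disjoint[OF assms(1,3,4)] assms
  by (auto simp: cliques_def nsets_def clique_def common_nbrs_def insert_commute)

text \<open>
  Both sides count the pairs of a \<open>k\<close>-clique \<open>Q\<close> containing \<open>S\<close> and a vertex \<open>v \<in> Q - S\<close>.
\<close>
lemma clique_count_step:
  assumes V: "finite V" and E: "E \<subseteq> [V]\<^bsup>2\<^esup>" and S: "S \<in> cliques s V E" "S \<noteq> {}" and k: "s < k"
  shows "(k - s) * clique_count k V E S = (\<Sum>v\<in>common_nbrs V E S. clique_count k V E (insert v S))"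
proof -
  let ?F = "{Q \<in> cliques k V E. S \<subseteq> Q}" and ?N = "common_nbrs V E S"
  have fin: "finite ?F" "finite ?N" using V by (auto simp: finite_cliques common_nbrs_def)
  have "(\<Sum>v\<in>?N. clique_count k V E (insert v S)) = (\<Sum>v\<in>?N. \<Sum>Q\<in>{Q\<in>?F. v \<in> Q}. 1)"
    unfolding clique_count_def by (intro sum.cong refl) (auto intro: arg_cong[where f = card])
  also have "\<dots> = (\<Sum>Q\<in>?F. \<Sum>v\<in>{v\<in>?N. v \<in> Q}. 1)"
    using fin by (intro sum.swap_restrict) auto
  also have "\<dots> = (\<Sum>Q\<in>?F. k - s)"
  proof (rule sum.cong[OF refl])
    fix Q assume Q: "Q \<in> ?F"
    then have Q': "Q \<subseteq> V" "S \<subseteq> Q" "\<And>u v. u \<in> Q \<Longrightarrow> v \<in> Q \<Longrightarrow> u \<noteq> v \<Longrightarrow> {u, v} \<in> E"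
      by (auto simp: cliques_def nsets_def clique_def)
    have "v \<in> ?N" if "v \<in> Q - S" for v
      using that Q'(1,2) by (auto simp: common_nbrs_def intro!: Q'(3))
    then have "{v\<in>?N. v \<in> Q} = Q - S"
      using common_nbrs_disjoint[OF E S(2)] by blast
    moreover have "card (Q - S) = k - s"
      using Q S by (auto simp: cliques_def nsets_def card_Diff_subset)
    ultimately show "(\<Sum>v\<in>{v\<in>?N. v \<in> Q}. 1) = k - s" by simp
  qed
  finally show ?thesis by (simp add: clique_count_def)
qed

lemma clique_count_self:
  assumes "finite V" "S \<in> cliques k V E"
  shows "clique_count k V E S = 1"
proof -
  have "{Q \<in> cliques k V E. S \<subseteq> Q} = {S}"
    using assms(2) by (auto simp: cliques_def nsets_def dest: card_subset_eq[OF _ _ sym])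
  then show ?thesis by (simp add: clique_count_def)
qed

text \<open>
  A clique with two more vertices arises from \<open>S\<close> by adding an edge inside the common neighbourhood.
\<close>
lemma clique_count_two_more:
  assumes V: "finite V" and E: "E \<subseteq> [V]\<^bsup>2\<^esup>" and S: "S \<in> cliques s V E" "S \<noteq> {}"
  shows "clique_count (s + 2) V E S = card {e \<in> E. e \<subseteq> common_nbrs V E S}"
proof -
  let ?N = "common_nbrs V E S"
  have dis: "S \<inter> ?N = {}" using common_nbrs_disjoint[OF E S(2)] by blast
  have S': "finite S" "card S = s" "S \<subseteq> V" "clique S E" using S by (auto simp: cliques_def nsets_def)
  have "bij_betw (\<lambda>Q. Q - S) {Q \<in> cliques (s + 2) V E. S \<subseteq> Q} {e \<in> E. e \<subseteq> ?N}"
  proof (rule bij_betwI[where g = "\<lambda>e. S \<union> e"])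
    show "(\<lambda>Q. Q - S) \<in> {Q \<in> cliques (s + 2) V E. S \<subseteq> Q} \<rightarrow> {e \<in> E. e \<subseteq> ?N}"
    proof safe
      fix Q assume Q: "Q \<in> cliques (s + 2) V E" "S \<subseteq> Q"
      have "Q - S \<in> [Q]\<^bsup>2\<^esup>" using Q S' by (auto simp: cliques_def nsets_def card_Diff_subset)
      then show "Q - S \<in> E" using clique_pairs_are_edges[OF Q(1)] by blast
      show "x \<in> ?N" if "x \<in> Q" "x \<notin> S" for x
        using that Q by (auto simp: common_nbrs_def cliques_def nsets_def clique_def)
    qed
    show "(\<lambda>e. S \<union> e) \<in> {e \<in> E. e \<subseteq> ?N} \<rightarrow> {Q \<in> cliques (s + 2) V E. S \<subseteq> Q}"
    proof safe
      fix e assume e: "e \<in> E" "e \<subseteq> ?N"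
      have e2: "card e = 2" "finite e" "e \<subseteq> V" using e E by (auto simp: nsets_def)
      have "card (S \<union> e) = s + 2" using e2 S' dis e by (subst card_Un_disjoint) auto
      moreover have "clique (S \<union> e) E"
        unfolding clique_def
      proof (intro ballI impI)
        fix v w assume vw: "v \<in> S \<union> e" "w \<in> S \<union> e" "v \<noteq> w"
        have eq: "e = {v, w}" if "v \<in> e" "w \<in> e"
          using that vw(3) e2 card_seteq[of e "{v, w}"] by simp
        have "{v, w} \<in> E" if "v \<in> S" "w \<in> e" for v w
          using that e by (auto simp: common_nbrs_def)
        from this[of v w] this[of w v] eq show "{v, w} \<in> E"
          using vw e(1) S'(4) by (auto simp: clique_def insert_commute)
      qed
      ultimately show "S \<union> e \<in> cliques (s + 2) V E" using e2 S' by (auto simp: cliques_def nsets_def)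
    qed
  qed (use dis in auto)
  then show ?thesis unfolding clique_count_def by (rule bij_betw_same_card)
qed

text \<open>
  Iterating \<open>clique_count_step\<close> from \<open>s\<close> to \<open>t\<close> vertices. Stopping at \<open>t < k\<close> allows the
  last vertices to be counted in another way, as in \<open>clique_count_two_more\<close>.
\<close>
lemma clique_count_lower:
  fixes l :: "nat \<Rightarrow> real"
  assumes V: "finite V" and E: "E \<subseteq> [V]\<^bsup>2\<^esup>" and st: "1 \<le> s" "s \<le> t" "t \<le> k" and lo: "lo \<ge> 0"
    and l0: "\<And>i. l i \<ge> 0"
    and deg: "\<And>i S. s \<le> i \<Longrightarrow> i < t \<Longrightarrow> S \<in> cliques i V E \<Longrightarrow> l i \<le> real (card (common_nbrs V E S))"
    and base: "\<And>S. S \<in> cliques t V E \<Longrightarrow> lo \<le> real (clique_count k V E S)"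
    and S: "S \<in> cliques s V E"
  shows "lo * (\<Prod>i=s..<t. l i / real (k - i)) \<le> real (clique_count k V E S)"
  using st(2,1) S deg
proof (induction s arbitrary: S rule: inc_induct)
  case base
  then show ?case using assms(9) by simp
next
  case (step s)
  let ?P = "lo * (\<Prod>i=Suc s..<t. l i / real (k - i))"
  let ?N = "common_nbrs V E S"
  have ne: "S \<noteq> {}" using step by (auto simp: cliques_def nsets_def)
  have sk: "s < k" using step st by simp
  have P0: "?P \<ge> 0" using lo l0 by (intro mult_nonneg_nonneg prod_nonneg) auto
  have "lo * (\<Prod>i=s..<t. l i / real (k - i)) = l s * ?P / real (k - s)"
    using step by (simp add: prod.atLeast_Suc_lessThan)
  also have "\<dots> \<le> real (card ?N) * ?P / real (k - s)"
    using step P0 by (intro divide_right_mono mult_right_mono) auto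
  also have "real (card ?N) * ?P = (\<Sum>v\<in>?N. ?P)" by simp
  also have "(\<Sum>v\<in>?N. ?P) \<le> (\<Sum>v\<in>?N. real (clique_count k V E (insert v S)))"
    by (intro sum_mono step.IH) (use step insert_common_nbr_in_cliques[OF E _ ne] in auto)
  also have "\<dots> = real ((k - s) * clique_count k V E S)"
    by (subst clique_count_step[OF V E step.prems(2) ne sk]) simp
  finally show ?case using sk by (simp add: divide_right_mono)
qed

lemma clique_count_upper:
  fixes l :: "nat \<Rightarrow> real"
  assumes V: "finite V" and E: "E \<subseteq> [V]\<^bsup>2\<^esup>" and st: "1 \<le> s" "s \<le> t" "t \<le> k" and hi: "hi \<ge> 0"
    and l0: "\<And>i. l i \<ge> 0"
    and deg: "\<And>i S. s \<le> i \<Longrightarrow> i < t \<Longrightarrow> S \<in> cliques i V E \<Longrightarrow> real (card (common_nbrs V E S)) \<le> l i"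
    and base: "\<And>S. S \<in> cliques t V E \<Longrightarrow> real (clique_count k V E S) \<le> hi"
    and S: "S \<in> cliques s V E"
  shows "real (clique_count k V E S) \<le> hi * (\<Prod>i=s..<t. l i / real (k - i))"
  using st(2,1) S deg
proof (induction s arbitrary: S rule: inc_induct)
  case base
  then show ?case using assms(9) by simp
next
  case (step s)
  let ?P = "hi * (\<Prod>i=Suc s..<t. l i / real (k - i))"
  let ?N = "common_nbrs V E S"
  have ne: "S \<noteq> {}" using step by (auto simp: cliques_def nsets_def)
  have sk: "s < k" using step st by simp
  have P0: "?P \<ge> 0" using hi l0 by (intro mult_nonneg_nonneg prod_nonneg) auto
  have "real ((k - s) * clique_count k V E S) = (\<Sum>v\<in>?N. real (clique_count k V E (insert v S)))"
    by (subst clique_count_step[OF V E step.prems(2) ne sk]) simp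
  also have "\<dots> \<le> (\<Sum>v\<in>?N. ?P)"
    by (intro sum_mono step.IH) (use step insert_common_nbr_in_cliques[OF E _ ne] in auto)
  also have "\<dots> = real (card ?N) * ?P" by simp
  also have "\<dots> \<le> l s * ?P"
    using step P0 by (intro mult_right_mono) auto
  finally have "real (clique_count k V E S) \<le> l s * ?P / real (k - s)"
    using sk by (simp add: field_simps)
  also have "\<dots> = hi * (\<Prod>i=s..<t. l i / real (k - i))"
    using step by (simp add: prod.atLeast_Suc_lessThan)
  finally show ?case .
qed

section \<open>Independent coins and a Chernoff bound\<close>

abbreviation coins :: "'a set \<Rightarrow> real \<Rightarrow> ('a \<Rightarrow> bool) pmf" where
  "coins A p \<equiv> Pi_pmf A False (\<lambda>_. bernoulli_pmf p)"

lemma finite_set_pmf_coins: "finite A \<Longrightarrow> finite (set_pmf (coins A p))"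
  by (simp add: set_Pi_pmf finite_PiE_dflt)

text \<open>
  Tossing all coins amounts to tossing those in \<open>A\<close> and those outside \<open>A\<close> independently; \<open>F\<close> depends
  on the former and \<open>G\<close> on the latter.
\<close>
lemma expectation_coins_mult:
  fixes F G :: "('a \<Rightarrow> bool) \<Rightarrow> real"
  assumes C: "finite C" and AB: "A \<subseteq> C" "B \<subseteq> C" "A \<inter> B = {}"
    and F: "\<And>f g. (\<And>x. x \<in> A \<Longrightarrow> f x = g x) \<Longrightarrow> F f = F g"
    and G: "\<And>f g. (\<And>x. x \<in> B \<Longrightarrow> f x = g x) \<Longrightarrow> G f = G g"
  shows "measure_pmf.expectation (coins C p) (\<lambda>f. F f * G f) =
         measure_pmf.expectation (coins C p) F * measure_pmf.expectation (coins C p) G"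
proof -
  define P R where "P = coins A p" and "R = coins (C - A) p"
  have fin: "finite A" "finite (C - A)" using C AB finite_subset by auto
  have finP: "finite (set_pmf P)" and finR: "finite (set_pmf R)"
    unfolding P_def R_def using fin by (auto intro: finite_set_pmf_coins)
  have "coins (A \<union> (C - A)) p = map_pmf (\<lambda>(f, g) x. if x \<in> A then f x else g x) (pair_pmf P R)"
    unfolding P_def R_def by (rule Pi_pmf_union) (use fin in auto)
  moreover have "A \<union> (C - A) = C" using AB by auto
  ultimately have C_eq: "coins C p = map_pmf (\<lambda>(f, g) x. if x \<in> A then f x else g x) (pair_pmf P R)" by simp
  have F': "F (\<lambda>x. if x \<in> A then f x else g x) = F f" for f g by (rule F) simp
  have G': "G (\<lambda>x. if x \<in> A then f x else g x) = G g" for f g by (rule G) (use AB in auto)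
  have pp: "pmf (pair_pmf P R) fg = pmf P (fst fg) * pmf R (snd fg)" for fg
    using pmf_pair[of P R "fst fg" "snd fg"] by simp
  have "measure_pmf.expectation (coins C p) (\<lambda>f. F f * G f) =
      measure_pmf.expectation (pair_pmf P R) (\<lambda>(f, g). F f * G g)"
    unfolding C_eq by (simp add: case_prod_unfold F' G')
  also have "\<dots> = (\<Sum>fg\<in>set_pmf P \<times> set_pmf R. (F (fst fg) * G (snd fg)) * pmf (pair_pmf P R) fg)"
    using finP finR by (subst integral_measure_pmf_real[where A = "set_pmf P \<times> set_pmf R"])
      (auto simp: case_prod_unfold)
  also have "\<dots> = (\<Sum>f\<in>set_pmf P. F f * pmf P f) * (\<Sum>g\<in>set_pmf R. G g * pmf R g)"
    by (simp add: sum_product sum.cartesian_product case_prod_unfold pp mult_ac)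
  also have "(\<Sum>f\<in>set_pmf P. F f * pmf P f) = measure_pmf.expectation P F"
    using finP by (subst integral_measure_pmf_real[where A = "set_pmf P"]) auto
  also have "\<dots> = measure_pmf.expectation (coins C p) F"
    unfolding C_eq using expectation_pair_pmf_fst[of P R F] by (simp add: case_prod_unfold F')
  also have "(\<Sum>g\<in>set_pmf R. G g * pmf R g) = measure_pmf.expectation R G"
    using finR by (subst integral_measure_pmf_real[where A = "set_pmf R"]) auto
  also have "\<dots> = measure_pmf.expectation (coins C p) G"
    unfolding C_eq using expectation_pair_pmf_snd[of P R G] by (simp add: case_prod_unfold G')
  finally show ?thesis .
qed

lemma prob_coins_inter:
  assumes C: "finite C" and AB: "A \<subseteq> C" "B \<subseteq> C" "A \<inter> B = {}"
    and X: "\<And>f g. (\<And>x. x \<in> A \<Longrightarrow> f x = g x) \<Longrightarrow> f \<in> X \<longleftrightarrow> g \<in> X"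
    and Y: "\<And>f g. (\<And>x. x \<in> B \<Longrightarrow> f x = g x) \<Longrightarrow> f \<in> Y \<longleftrightarrow> g \<in> Y"
  shows "measure_pmf.prob (coins C p) (X \<inter> Y) =
         measure_pmf.prob (coins C p) X * measure_pmf.prob (coins C p) Y"
proof -
  have "measure_pmf.expectation (coins C p) (\<lambda>f. indicat_real X f * indicat_real Y f) =
     measure_pmf.expectation (coins C p) (indicat_real X) * measure_pmf.expectation (coins C p) (indicat_real Y)"
  proof (rule expectation_coins_mult[OF C AB])
    show "indicat_real X f = indicat_real X g" if "\<And>x. x \<in> A \<Longrightarrow> f x = g x" for f g
      unfolding indicator_def using X[OF that] by (simp only:)
    show "indicat_real Y f = indicat_real Y g" if "\<And>x. x \<in> B \<Longrightarrow> f x = g x" for f g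
      unfolding indicator_def using Y[OF that] by (simp only:)
  qed
  then show ?thesis by (simp flip: indicator_inter_arith)
qed

lemma prob_coins_all_heads:
  assumes C: "finite C" and B: "B \<subseteq> C" and p: "0 \<le> p" "p \<le> 1"
  shows "measure_pmf.prob (coins C p) {f. \<forall>b\<in>B. f b} = p ^ card B"
proof -
  have "{f. \<forall>b\<in>B. f b} = Pi C (\<lambda>b. if b \<in> B then {True} else UNIV)"
    using B by (auto simp: Pi_def)
  then have "measure_pmf.prob (coins C p) {f. \<forall>b\<in>B. f b}
      = (\<Prod>b\<in>C. measure_pmf.prob (bernoulli_pmf p) (if b \<in> B then {True} else UNIV))"
    by (simp only: measure_Pi_pmf_Pi[OF C])
  also have "\<dots> = (\<Prod>b\<in>C. if b \<in> B then p else 1)"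
    using p by (intro prod.cong) (auto simp: measure_pmf_single)
  also have "\<dots> = p ^ card B"
    using C B by (simp add: prod.If_cases Int_absorb1)
  finally show ?thesis .
qed

text \<open>
  Blocks of one size \<open>s\<close> cover both applications: the stars that join a vertex to a fixed set,
  and the single edges (\<open>s = 1\<close>).
\<close>
definition heads_blocks :: "'i set \<Rightarrow> ('i \<Rightarrow> 'a set) \<Rightarrow> ('a \<Rightarrow> bool) \<Rightarrow> nat" where
  "heads_blocks I B f = card {i \<in> I. \<forall>b\<in>B i. f b}"

text \<open>
  This is the generating function of the binomial distribution with success probability \<open>p\<^sup>s\<close>: disjoint blocks
  are independent, and one block contributes a factor \<open>x\<close> with probability \<open>p\<^sup>s\<close> and \<open>1\<close> otherwise.
\<close>
lemma expectation_power_heads_blocks: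
  fixes x :: real
  assumes C: "finite C" and I: "finite I" and B: "\<And>i. i \<in> I \<Longrightarrow> B i \<subseteq> C \<and> card (B i) = s"
    and dis: "disjoint_family_on B I" and p: "0 \<le> p" "p \<le> 1"
  shows "measure_pmf.expectation (coins C p) (\<lambda>f. x ^ heads_blocks I B f) = (1 + (x - 1) * p ^ s) ^ card I"
  using I B dis
proof (induction I rule: finite_induct)
  case empty
  then show ?case by (simp add: heads_blocks_def)
next
  case (insert j I)
  let ?E = "measure_pmf.expectation (coins C p)"
  let ?X = "{f. \<forall>b\<in>B j. f b}"
  have int: "integrable (measure_pmf (coins C p)) F" for F :: "_ \<Rightarrow> real"
    using finite_set_pmf_coins[OF C] by (rule integrable_measure_pmf_finite)
  have split: "x ^ heads_blocks (insert j I) B f = (1 + (x - 1) * indicator ?X f) * x ^ heads_blocks I B f" for f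
  proof (cases "f \<in> ?X")
    case True
    then have "{i \<in> insert j I. \<forall>b\<in>B i. f b} = insert j {i \<in> I. \<forall>b\<in>B i. f b}" by auto
    with True insert show ?thesis by (simp add: heads_blocks_def)
  next
    case False
    then have "{i \<in> insert j I. \<forall>b\<in>B i. f b} = {i \<in> I. \<forall>b\<in>B i. f b}" by auto
    with False show ?thesis by (simp add: heads_blocks_def)
  qed
  have dj: "B j \<inter> (\<Union>i\<in>I. B i) = {}"
    using insert.prems(2) insert.hyps(2) by (fastforce simp: disjoint_family_on_def)
  have "?E (\<lambda>f. x ^ heads_blocks (insert j I) B f)
      = ?E (\<lambda>f. 1 + (x - 1) * indicator ?X f) * ?E (\<lambda>f. x ^ heads_blocks I B f)"
    unfolding split
  proof (rule expectation_coins_mult[OF C _ _ dj])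
    show "B j \<subseteq> C" "(\<Union>i\<in>I. B i) \<subseteq> C" using insert.prems(1) by auto
    show "1 + (x - 1) * indicator ?X f = 1 + (x - 1) * indicator ?X g"
      if "\<And>y. y \<in> B j \<Longrightarrow> f y = g y" for f g
      using that by (auto simp: indicator_def)
    show "x ^ heads_blocks I B f = x ^ heads_blocks I B g"
      if "\<And>y. y \<in> (\<Union>i\<in>I. B i) \<Longrightarrow> f y = g y" for f g
    proof -
      have "{i \<in> I. \<forall>b\<in>B i. f b} = {i \<in> I. \<forall>b\<in>B i. g b}" using that by blast
      then show ?thesis by (simp add: heads_blocks_def)
    qed
  qed
  also have "?E (\<lambda>f. 1 + (x - 1) * indicator ?X f) = 1 + (x - 1) * p ^ s"
    using prob_coins_all_heads[OF C _ p, of "B j"] insert.prems(1) int by simp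
  also have "?E (\<lambda>f. x ^ heads_blocks I B f) = (1 + (x - 1) * p ^ s) ^ card I"
    using insert.prems by (intro insert.IH) (auto simp: disjoint_family_on_def)
  finally show ?case using insert.hyps by simp
qed

text \<open>
  The exponent in the Chernoff bound for deviating from the mean by the factor \<open>x\<close>.
\<close>
definition chernoff_rate :: "real \<Rightarrow> real" where
  "chernoff_rate x = x * ln x - x + 1"

lemma chernoff_rate_pos: "x > 0 \<Longrightarrow> x \<noteq> 1 \<Longrightarrow> chernoff_rate x > 0"
proof -
  assume x: "x > 0" "x \<noteq> 1"
  then have "ln (1 / x) < 1 / x - 1"
    using ln_le_minus_one[of "1 / x"] ln_eq_minus_one[of "1 / x"] by fastforce
  then have "- ln x < 1 / x - 1" using x by (simp add: ln_div)
  then have "x * (- ln x) < x * (1 / x - 1)" using x by (simp only: mult_less_cancel_left_pos)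
  then show ?thesis using x by (simp add: chernoff_rate_def algebra_simps)
qed

text \<open>
  Markov's inequality for \<open>x ^ Z\<close>, where \<open>Z\<close> counts the blocks showing only heads. The base \<open>x\<close> is the
  deviation factor itself, which is the optimal choice. Both tails are treated at once: for \<open>x > 1\<close>
  the event \<open>T\<close> has \<open>Z \<ge> x \<mu>\<close> with \<open>\<mu>\<close> at least the mean, and for \<open>x < 1\<close> it has
  \<open>Z \<le> x \<mu>\<close> with \<open>\<mu>\<close> at most the mean.
\<close>
lemma chernoff_heads_blocks:
  fixes x \<mu> :: real
  assumes C: "finite C" and I: "finite I" and B: "\<And>i. i \<in> I \<Longrightarrow> B i \<subseteq> C \<and> card (B i) = s"
    and dis: "disjoint_family_on B I" and p: "0 \<le> p" "p \<le> 1" and x: "x > 0"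
    and \<mu>: "(x - 1) * (real (card I) * p ^ s) \<le> (x - 1) * \<mu>"
    and T: "\<And>f. f \<in> T \<Longrightarrow> x powr (x * \<mu>) \<le> x powr real (heads_blocks I B f)"
  shows "measure_pmf.prob (coins C p) T \<le> exp (- chernoff_rate x * \<mu>)"
proof -
  let ?E = "measure_pmf.expectation (coins C p)"
  have int: "integrable (measure_pmf (coins C p)) F" for F :: "_ \<Rightarrow> real"
    using finite_set_pmf_coins[OF C] by (rule integrable_measure_pmf_finite)
  have "x powr (x * \<mu>) * measure_pmf.prob (coins C p) T = ?E (\<lambda>f. x powr (x * \<mu>) * indicator T f)"
    by simp
  also have "\<dots> \<le> ?E (\<lambda>f. x ^ heads_blocks I B f)"
    using T x by (intro integral_mono int) (auto simp: indicator_def powr_realpow)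
  also have "\<dots> = (1 + (x - 1) * p ^ s) ^ card I"
    by (rule expectation_power_heads_blocks[OF C I B dis p])
  also have "\<dots> \<le> exp ((x - 1) * p ^ s) ^ card I"
  proof (rule power_mono)
    have "(1 - x) * p ^ s \<le> 1"
    proof (cases "x \<le> 1")
      case True
      then show ?thesis using x p by (intro mult_le_one) (auto simp: power_le_one)
    next
      case False
      then have "(1 - x) * p ^ s \<le> 0" using p by (intro mult_nonpos_nonneg) auto
      then show ?thesis by linarith
    qed
    then show "0 \<le> 1 + (x - 1) * p ^ s" by (simp add: algebra_simps)
  qed simp
  also have "\<dots> = exp ((x - 1) * (real (card I) * p ^ s))"
    by (simp add: mult_ac flip: exp_of_nat_mult)
  also have "\<dots> \<le> exp ((x - 1) * \<mu>)" using \<mu> by simp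
  finally have "measure_pmf.prob (coins C p) T \<le> exp ((x - 1) * \<mu>) / x powr (x * \<mu>)"
    using x by (simp add: field_simps)
  also have "\<dots> = exp (- chernoff_rate x * \<mu>)"
    using x by (simp add: powr_def chernoff_rate_def algebra_simps flip: exp_diff)
  finally show ?thesis .
qed

lemma chernoff_heads_blocks_upper:
  fixes x \<mu> :: real
  assumes "finite C" "finite I" "\<And>i. i \<in> I \<Longrightarrow> B i \<subseteq> C \<and> card (B i) = s"
    and "disjoint_family_on B I" "0 \<le> p" "p \<le> 1" and x: "x > 1"
    and \<mu>: "real (card I) * p ^ s \<le> \<mu>"
  shows "measure_pmf.prob (coins C p) {f. real (heads_blocks I B f) > x * \<mu>} \<le> exp (- chernoff_rate x * \<mu>)"
  using assms by (intro chernoff_heads_blocks[where I = I and B = B and s = s]) (auto intro!: mult_left_mono powr_mono)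

lemma chernoff_heads_blocks_lower:
  fixes x \<mu> :: real
  assumes "finite C" "finite I" "\<And>i. i \<in> I \<Longrightarrow> B i \<subseteq> C \<and> card (B i) = s"
    and "disjoint_family_on B I" "0 \<le> p" "p \<le> 1" and x: "0 < x" "x < 1"
    and \<mu>: "\<mu> \<le> real (card I) * p ^ s"
  shows "measure_pmf.prob (coins C p) {f. real (heads_blocks I B f) < x * \<mu>} \<le> exp (- chernoff_rate x * \<mu>)"
  using assms by (intro chernoff_heads_blocks[where I = I and B = B and s = s]) (auto intro!: mult_left_mono_neg powr_mono')

section \<open>Common neighbourhoods in the random graph\<close>

abbreviation edge_set :: "'a set \<Rightarrow> ('a set \<Rightarrow> bool) \<Rightarrow> 'a set set" where
  "edge_set V f \<equiv> {e \<in> [V]\<^bsup>2\<^esup>. f e}"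

text \<open>
  The common neighbours are the vertices whose star to \<open>S\<close> is a block showing only heads. No vertex of \<open>S\<close> occurs,
  because an edge has two distinct ends.
\<close>
lemma common_nbrs_edge_set:
  assumes "S \<subseteq> V" "S \<noteq> {}"
  shows "common_nbrs V (edge_set V f) S = {v \<in> V - S. \<forall>e\<in>(\<lambda>u. {u, v}) ` S. f e}"
  using assms by (auto simp: common_nbrs_def)

lemma star_blocks:
  assumes "S \<subseteq> V" "finite V"
  shows "v \<in> V - S \<Longrightarrow> (\<lambda>u. {u, v}) ` S \<subseteq> [V]\<^bsup>2\<^esup> \<and> card ((\<lambda>u. {u, v}) ` S) = card S"
    and "disjoint_family_on (\<lambda>v. (\<lambda>u. {u, v}) ` S) (V - S)"
  using assms
  by (auto intro!: card_image simp: inj_on_def disjoint_family_on_def doubleton_eq_iff)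

lemma prob_many_common_nbrs:
  assumes V: "finite V" and S: "S \<subseteq> V" "S \<noteq> {}" and p: "0 \<le> p" "p \<le> 1" and \<epsilon>: "\<epsilon> > 0"
  shows "measure_pmf.prob (coins ([V]\<^bsup>2\<^esup>) p)
     {f. real (card (common_nbrs V (edge_set V f) S)) > (1 + \<epsilon>) * (real (card V) * p ^ card S)}
     \<le> exp (- chernoff_rate (1 + \<epsilon>) * (real (card V) * p ^ card S))"
proof -
  have "real (card (V - S)) * p ^ card S \<le> real (card V) * p ^ card S"
    using V p by (intro mult_right_mono) (auto intro: card_mono)
  then show ?thesis
    unfolding common_nbrs_edge_set[OF S] heads_blocks_def[symmetric]
    using V p \<epsilon> star_blocks[OF S(1) V]
    by (intro chernoff_heads_blocks_upper[where s = "card S"]) (auto simp: finite_imp_finite_nsets)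
qed

text \<open>
  One factor \<open>1 - \<epsilon>\<close> is the deviation from the mean, the other one makes up for the vertices of \<open>S\<close>
  itself, which are not available.
\<close>
lemma prob_few_common_nbrs:
  assumes V: "finite V" and S: "S \<subseteq> V" "S \<noteq> {}" and p: "0 \<le> p" "p \<le> 1" and \<epsilon>: "0 < \<epsilon>" "\<epsilon> < 1"
    and large: "real (card S) \<le> \<epsilon> * real (card V)"
  shows "measure_pmf.prob (coins ([V]\<^bsup>2\<^esup>) p)
     {f. real (card (common_nbrs V (edge_set V f) S)) < (1 - \<epsilon>)\<^sup>2 * (real (card V) * p ^ card S)}
     \<le> exp (- chernoff_rate (1 - \<epsilon>) * ((1 - \<epsilon>) * (real (card V) * p ^ card S)))"
proof -
  have "real (card (V - S)) = real (card V) - real (card S)"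
    using V S by (simp add: card_Diff_subset finite_subset card_mono of_nat_diff)
  then have "(1 - \<epsilon>) * real (card V) \<le> real (card (V - S))"
    using large by (simp add: algebra_simps)
  then have "(1 - \<epsilon>) * (real (card V) * p ^ card S) \<le> real (card (V - S)) * p ^ card S"
    using p by (simp only: mult.assoc[symmetric]) (intro mult_right_mono, auto)
  then show ?thesis
    unfolding common_nbrs_edge_set[OF S] heads_blocks_def[symmetric] power2_eq_square mult.assoc
    using V p \<epsilon> star_blocks[OF S(1) V]
    by (intro chernoff_heads_blocks_lower[where s = "card S"]) (auto simp: finite_imp_finite_nsets)
qed

text \<open>
  For the sizes of \<open>W\<close> considered, the mean number of edges lies between \<open>y\<^sup>2 p / 16\<close> and \<open>2 y\<^sup>2 p\<close>; a
  deviation by another factor \<open>2\<close> is exponentially unlikely.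
\<close>
lemma prob_edges_within:
  assumes V: "finite V" and W: "W \<subseteq> V" and p: "0 \<le> p" "p \<le> 1"
    and y: "y \<ge> 4" "y / 2 \<le> real (card W)" "real (card W) \<le> 2 * y"
  shows "measure_pmf.prob (coins ([V]\<^bsup>2\<^esup>) p)
     {f. \<not> (y\<^sup>2 * p / 32 \<le> real (card (edge_set W f)) \<and> real (card (edge_set W f)) \<le> 4 * (y\<^sup>2 * p))}
     \<le> exp (- chernoff_rate (1/2) * (y\<^sup>2 * p / 16)) + exp (- chernoff_rate 2 * (2 * (y\<^sup>2 * p)))"
proof -
  let ?P = "measure_pmf.prob (coins ([V]\<^bsup>2\<^esup>) p)"
  let ?B = "\<lambda>e. {e}" and ?w = "real (card W)"
  have finW: "finite W" using V W finite_subset by auto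
  have hb: "real (card (edge_set W f)) = real (heads_blocks ([W]\<^bsup>2\<^esup>) ?B f)" for f :: "'a set \<Rightarrow> bool"
    by (simp add: heads_blocks_def)
  have prems: "finite ([V]\<^bsup>2\<^esup>)" "finite ([W]\<^bsup>2\<^esup>)"
    "\<And>e. e \<in> [W]\<^bsup>2\<^esup> \<Longrightarrow> ?B e \<subseteq> [V]\<^bsup>2\<^esup> \<and> card (?B e) = 1" "disjoint_family_on ?B ([W]\<^bsup>2\<^esup>)"
    using V finW nsets_mono[OF W, of 2] by (auto simp: finite_imp_finite_nsets disjoint_family_on_def)
  have "even (card W * (card W - 1))" by (cases "card W") auto
  then have "real (card ([W]\<^bsup>2\<^esup>)) = real (card W * (card W - 1)) / 2"
    unfolding card_nsets[OF finW] choose_two by (simp add: real_of_nat_div)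
  then have cW: "real (card ([W]\<^bsup>2\<^esup>)) = ?w * (?w - 1) / 2"
    by (cases "card W") (auto simp: algebra_simps)
  have "y / 2 * (y / 4) \<le> ?w * (?w - 1)" using y by (intro mult_mono) auto
  then have "y\<^sup>2 / 16 \<le> real (card ([W]\<^bsup>2\<^esup>))" unfolding cW by (simp add: power2_eq_square)
  then have lo: "y\<^sup>2 * p / 16 \<le> real (card ([W]\<^bsup>2\<^esup>)) * p ^ 1"
    using mult_right_mono[OF _ p(1)] by fastforce
  \<comment> \<open>The factor \<open>(2 y)\<^sup>2\<close> is halved by passing from ordered to unordered pairs.\<close>
  have "?w * (?w - 1) \<le> (2 * y) * (2 * y)" using y by (intro mult_mono) auto
  then have "real (card ([W]\<^bsup>2\<^esup>)) \<le> 2 * y\<^sup>2" unfolding cW by (simp add: power2_eq_square)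
  then have hi: "real (card ([W]\<^bsup>2\<^esup>)) * p ^ 1 \<le> 2 * (y\<^sup>2 * p)"
    using mult_right_mono[OF _ p(1)] by fastforce
  have "?P {f. real (card (edge_set W f)) < 1 / 2 * (y\<^sup>2 * p / 16)} \<le> exp (- chernoff_rate (1/2) * (y\<^sup>2 * p / 16))"
    unfolding hb by (rule chernoff_heads_blocks_lower[OF prems p _ _ lo]) auto
  moreover have "?P {f. real (card (edge_set W f)) > 2 * (2 * (y\<^sup>2 * p))} \<le> exp (- chernoff_rate 2 * (2 * (y\<^sup>2 * p)))"
    unfolding hb by (rule chernoff_heads_blocks_upper[OF prems p _ hi]) auto
  moreover have "?P {f. \<not> (y\<^sup>2 * p / 32 \<le> real (card (edge_set W f)) \<and> real (card (edge_set W f)) \<le> 4 * (y\<^sup>2 * p))}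
     \<le> ?P {f. real (card (edge_set W f)) < 1 / 2 * (y\<^sup>2 * p / 16)} + ?P {f. real (card (edge_set W f)) > 2 * (2 * (y\<^sup>2 * p))}"
    by (rule order_trans[OF measure_pmf.finite_measure_mono measure_Un_le]) (auto simp: not_le)
  ultimately show ?thesis by linarith
qed

text \<open>
  The event that the common neighbourhood of \<open>S\<close> is \<open>W\<close> depends only on edges between \<open>S\<close> and the other
  vertices, hence is independent of the edges inside \<open>W\<close>. Summing \<open>prob_edges_within\<close> over all \<open>W\<close> of
  admissible size gives the bound.
\<close>
lemma prob_edges_within_common_nbrs:
  assumes V: "finite V" and S: "S \<subseteq> V" "S \<noteq> {}" and p: "0 \<le> p" "p \<le> 1" and y: "y \<ge> 4"
  defines "N \<equiv> \<lambda>f. common_nbrs V (edge_set V f) S"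
  shows "measure_pmf.prob (coins ([V]\<^bsup>2\<^esup>) p)
     {f. y / 2 \<le> real (card (N f)) \<and> real (card (N f)) \<le> 2 * y \<and>
       \<not> (y\<^sup>2 * p / 32 \<le> real (card (edge_set (N f) f)) \<and> real (card (edge_set (N f) f)) \<le> 4 * (y\<^sup>2 * p))}
     \<le> exp (- chernoff_rate (1/2) * (y\<^sup>2 * p / 16)) + exp (- chernoff_rate 2 * (2 * (y\<^sup>2 * p)))"
proof -
  let ?P = "measure_pmf.prob (coins ([V]\<^bsup>2\<^esup>) p)"
  let ?b = "exp (- chernoff_rate (1/2) * (y\<^sup>2 * p / 16)) + exp (- chernoff_rate 2 * (2 * (y\<^sup>2 * p)))"
  let ?T = "{f. y / 2 \<le> real (card (N f)) \<and> real (card (N f)) \<le> 2 * y \<and>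
       \<not> (y\<^sup>2 * p / 32 \<le> real (card (edge_set (N f) f)) \<and> real (card (edge_set (N f) f)) \<le> 4 * (y\<^sup>2 * p))}"
  define X where "X W = {f. N f = W}" for W
  define Y where "Y W = {f. \<not> (y\<^sup>2 * p / 32 \<le> real (card (edge_set W f)) \<and> real (card (edge_set W f)) \<le> 4 * (y\<^sup>2 * p))}" for W :: "'a set"
  define \<W> where "\<W> = {W. W \<subseteq> V - S \<and> y / 2 \<le> real (card W) \<and> real (card W) \<le> 2 * y}"
  have fin\<W>: "finite \<W>" using V by (simp add: \<W>_def)
  have N_sub: "N f \<subseteq> V - S" for f
    unfolding N_def common_nbrs_edge_set[OF S] by auto
  have "?T \<subseteq> (\<Union>W\<in>\<W>. X W \<inter> Y W)"
    using N_sub by (auto simp: \<W>_def X_def Y_def)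
  then have "?P ?T \<le> ?P (\<Union>W\<in>\<W>. X W \<inter> Y W)"
    by (intro measure_pmf.finite_measure_mono) auto
  also have "\<dots> \<le> (\<Sum>W\<in>\<W>. ?P (X W \<inter> Y W))"
    using fin\<W> by (intro measure_pmf.finite_measure_subadditive_finite) auto
  also have "\<dots> \<le> (\<Sum>W\<in>\<W>. ?P (X W) * ?b)"
  proof (rule sum_mono)
    fix W assume "W \<in> \<W>"
    then have W: "W \<subseteq> V - S" "y / 2 \<le> real (card W)" "real (card W) \<le> 2 * y" by (auto simp: \<W>_def)
    have "?P (X W \<inter> Y W) = ?P (X W) * ?P (Y W)"
    proof (rule prob_coins_inter)
      show "finite ([V]\<^bsup>2\<^esup>)" using V by (rule finite_imp_finite_nsets)
      show "(\<Union>v\<in>V - S. (\<lambda>u. {u, v}) ` S) \<subseteq> [V]\<^bsup>2\<^esup>" using S by auto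
      show "[W]\<^bsup>2\<^esup> \<subseteq> [V]\<^bsup>2\<^esup>" using W by (intro nsets_mono) auto
      show "(\<Union>v\<in>V - S. (\<lambda>u. {u, v}) ` S) \<inter> [W]\<^bsup>2\<^esup> = {}" using W by auto
      show "f \<in> X W \<longleftrightarrow> g \<in> X W" if "\<And>e. e \<in> (\<Union>v\<in>V - S. (\<lambda>u. {u, v}) ` S) \<Longrightarrow> f e = g e" for f g
      proof -
        have "N f = N g" unfolding N_def common_nbrs_edge_set[OF S] using that by auto
        then show ?thesis by (simp add: X_def)
      qed
      show "f \<in> Y W \<longleftrightarrow> g \<in> Y W" if "\<And>e. e \<in> [W]\<^bsup>2\<^esup> \<Longrightarrow> f e = g e" for f g
      proof -
        have "edge_set W f = edge_set W g" using that by auto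
        then show ?thesis by (simp add: Y_def)
      qed
    qed
    also have "\<dots> \<le> ?P (X W) * ?b"
      unfolding Y_def using W y V p by (intro mult_left_mono prob_edges_within) auto
    finally show "?P (X W \<inter> Y W) \<le> ?P (X W) * ?b" .
  qed
  also have "\<dots> = ?P (\<Union>W\<in>\<W>. X W) * ?b"
    using fin\<W> by (subst measure_pmf.finite_measure_finite_Union)
      (auto simp: X_def disjoint_family_on_def sum_distrib_right)
  also have "\<dots> \<le> 1 * ?b" by (intro mult_right_mono) (auto intro: add_nonneg_nonneg)
  finally show "?P ?T \<le> ?b" by simp
qed

section \<open>Pseudorandom graphs\<close>

text \<open>
  If the common neighbourhoods of \<open>i\<close>-cliques have size about \<open>y i\<close>, then an edge lies in about \<open>D\<close> many
  \<open>q\<close>-cliques and in at least about \<open>lo \<cdot> D \<cdot> \<kappa>\<close> many \<open>(q+2)\<close>-cliques, where \<open>\<kappa>\<close> accounts for the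
  different numbers of orders in which the vertices can be added. Only the ratio of \<open>hi\<close> and \<open>lo\<close>
  enters the final condition.
\<close>
lemma fractional_clique_decomposition_of_pseudorandom:
  fixes y :: "nat \<Rightarrow> real" and a b lo hi \<eta> :: real
  assumes V: "finite V" and E: "E \<subseteq> [V]\<^bsup>2\<^esup>" and q: "q \<ge> 2" and y: "\<And>i. y i > 0"
    and a: "a > 0" and b: "b \<ge> 0" and lo: "lo > 0" and hi: "hi \<ge> 0"
    and deg: "\<And>i S. 2 \<le> i \<Longrightarrow> i < q \<Longrightarrow> S \<in> cliques i V E \<Longrightarrow>
        a * y i \<le> real (card (common_nbrs V E S)) \<and> real (card (common_nbrs V E S)) \<le> b * y i"
    and pairs: "\<And>S. S \<in> cliques q V E \<Longrightarrow>
        lo \<le> real (card {e \<in> E. e \<subseteq> common_nbrs V E S}) \<and> real (card {e \<in> E. e \<subseteq> common_nbrs V E S}) \<le> hi"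
    and \<eta>: "1 - \<eta> \<le> a ^ (q - 2)" "b ^ (q - 2) \<le> 1 + \<eta>" "\<eta> \<ge> 0"
    and small: "hi * real ((q + 2) choose 2) * \<eta> \<le> lo * a ^ (q - 2) * (\<Prod>i=2..<q. real (q - i) / real (q + 2 - i))"
  shows "\<exists>\<psi>. fractional_clique_decomposition q V E \<psi>"
proof -
  define D where "D = (\<Prod>i=2..<q. y i / real (q - i))"
  define \<kappa> where "\<kappa> = (\<Prod>i=2..<q. real (q - i) / real (q + 2 - i))"
  have D: "D > 0" unfolding D_def using y by (intro prod_pos) auto
  have \<kappa>: "\<kappa> > 0" unfolding \<kappa>_def by (intro prod_pos) auto
  have scale: "(\<Prod>i=2..<q. c * y i / real (q - i)) = c ^ (q - 2) * D" for c
    by (simp add: D_def prod.distrib flip: times_divide_eq_right)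
  have scale2: "(\<Prod>i=2..<q. a * y i / real (q + 2 - i)) = a ^ (q - 2) * D * \<kappa>"
  proof -
    have "(\<Prod>i=2..<q. a * y i / real (q + 2 - i))
        = (\<Prod>i=2..<q. a * (y i / real (q - i)) * (real (q - i) / real (q + 2 - i)))"
      by (intro prod.cong) auto
    then show ?thesis by (simp only: D_def \<kappa>_def prod.distrib prod_constant card_atLeastLessThan)
  qed
  have cnt2: "real (clique_count (q + 2) V E S) = real (card {e \<in> E. e \<subseteq> common_nbrs V E S})"
    if "S \<in> cliques q V E" for S
  proof -
    have "S \<noteq> {}" using that q by (auto simp: cliques_def nsets_def)
    then show ?thesis using clique_count_two_more[OF V E that] by simp
  qed
  have nonneg: "0 \<le> a * y i" "0 \<le> b * y i" for i using a b y[of i] by auto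
  show ?thesis
  proof (rule fractional_clique_decomposition_of_regularity[OF V E q D _ hi \<eta>(3)])
    show "0 < lo * (a ^ (q - 2) * D * \<kappa>)" using lo a D \<kappa> by simp
    show "real (clique_count (q + 2) V E Q) \<le> hi" if "Q \<in> cliques q V E" for Q
      using pairs[OF that] cnt2[OF that] by simp
    show "hi * real ((q + 2) choose 2) * \<eta> * D \<le> lo * (a ^ (q - 2) * D * \<kappa>)"
      using mult_right_mono[OF small less_imp_le[OF D]] by (simp add: \<kappa>_def mult_ac)
    fix e assume "e \<in> E"
    then have e: "e \<in> cliques 2 V E" using E by (simp add: edge_in_cliques_2)
    have "lo * (\<Prod>i=2..<q. a * y i / real (q + 2 - i)) \<le> real (clique_count (q + 2) V E e)"
      by (rule clique_count_lower[OF V E _ q]) (use lo nonneg deg e pairs cnt2 in auto)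
    then show "lo * (a ^ (q - 2) * D * \<kappa>) \<le> real (clique_count (q + 2) V E e)"
      by (simp only: scale2)
    have "1 * (\<Prod>i=2..<q. a * y i / real (q - i)) \<le> real (clique_count q V E e)"
      by (rule clique_count_lower[OF V E _ q]) (use nonneg deg e clique_count_self[OF V] in auto)
    then have "a ^ (q - 2) * D \<le> real (clique_count q V E e)" by (simp only: scale mult_1)
    moreover have "real (clique_count q V E e) \<le> 1 * (\<Prod>i=2..<q. b * y i / real (q - i))"
      by (rule clique_count_upper[OF V E _ q]) (use nonneg deg e clique_count_self[OF V] in auto)
    then have "real (clique_count q V E e) \<le> b ^ (q - 2) * D" by (simp only: scale mult_1)
    moreover have "(1 - \<eta>) * D \<le> a ^ (q - 2) * D" "b ^ (q - 2) * D \<le> (1 + \<eta>) * D"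
      using \<eta> D by (auto intro: mult_right_mono)
    ultimately show "\<bar>real (clique_count q V E e) - D\<bar> \<le> \<eta> * D"
      by (simp add: abs_le_iff algebra_simps)
  qed
qed

text \<open>
  The lower bound has the form \<open>(1 - \<epsilon>)\<^sup>2\<close> to match \<open>prob_few_common_nbrs\<close>. The constants \<open>1/32\<close> and \<open>4\<close> are
  those of \<open>prob_edges_within\<close>; a small \<open>\<epsilon>\<close> will outweigh their ratio.
\<close>
definition pseudorandom :: "nat \<Rightarrow> real \<Rightarrow> real \<Rightarrow> 'a set \<Rightarrow> 'a set set \<Rightarrow> bool" where
  "pseudorandom q \<epsilon> p V E \<longleftrightarrow> (\<forall>S \<subseteq> V. 2 \<le> card S \<and> card S \<le> q \<longrightarrow>
     (1 - \<epsilon>)\<^sup>2 * (real (card V) * p ^ card S) \<le> real (card (common_nbrs V E S)) \<and>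
     real (card (common_nbrs V E S)) \<le> (1 + \<epsilon>) * (real (card V) * p ^ card S) \<and>
     (card S = q \<longrightarrow>
       (real (card V) * p ^ q)\<^sup>2 * p / 32 \<le> real (card {e \<in> E. e \<subseteq> common_nbrs V E S}) \<and>
       real (card {e \<in> E. e \<subseteq> common_nbrs V E S}) \<le> 4 * ((real (card V) * p ^ q)\<^sup>2 * p)))"

lemma card_small_subsets_le:
  assumes "finite V" "card V > 0"
  shows "card {S. S \<subseteq> V \<and> 2 \<le> card S \<and> card S \<le> q} \<le> (q + 1) * card V ^ q"
proof -
  have "card {S. S \<subseteq> V \<and> 2 \<le> card S \<and> card S \<le> q} \<le> card (\<Union>i\<in>{..q}. {S. S \<subseteq> V \<and> card S = i})"
    using assms by (intro card_mono) auto
  also have "\<dots> \<le> (\<Sum>i\<in>{..q}. card {S. S \<subseteq> V \<and> card S = i})"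
    by (rule card_UN_le) simp
  also have "\<dots> = (\<Sum>i\<in>{..q}. card V choose i)"
    using assms by (simp add: n_subsets)
  also have "\<dots> \<le> (\<Sum>i\<in>{..q}. card V ^ q)"
  proof (rule sum_mono)
    fix i assume "i \<in> {..q}"
    then have "card V ^ i \<le> card V ^ q" using assms by (intro power_increasing) auto
    moreover have "card V choose i \<le> card V ^ i"
      by (cases "i \<le> card V") (auto intro: binomial_le_pow simp: binomial_eq_0)
    ultimately show "card V choose i \<le> card V ^ q" by linarith
  qed
  finally show ?thesis by simp
qed

text \<open>
  A union bound over all vertex sets \<open>S\<close>. The event \<open>T3 S\<close> requires a common neighbourhood of roughly the right size;
  if that fails, then \<open>T1 S\<close> or \<open>T2 S\<close> occurs. The quantity \<open>L\<close> is a common lower bound for all the means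
  involved.
\<close>
lemma prob_not_pseudorandom:
  fixes V :: "'a set" and p \<epsilon> c L :: real
  assumes V: "finite V" and p: "0 \<le> p" "p \<le> 1" and q: "q \<ge> 2"
    and \<epsilon>: "0 < \<epsilon>" "\<epsilon> < 1" "1 / 2 \<le> (1 - \<epsilon>)\<^sup>2" and n: "real q \<le> \<epsilon> * real (card V)"
    and L: "4 \<le> real (card V) * p ^ q" "L \<le> real (card V) * p ^ q" "L \<le> (real (card V) * p ^ q)\<^sup>2 * p" "0 \<le> L"
    and c: "0 < c" "c \<le> chernoff_rate (1 + \<epsilon>)" "c \<le> chernoff_rate (1 - \<epsilon>) * (1 - \<epsilon>)"
      "c \<le> chernoff_rate (1/2) / 16" "c \<le> chernoff_rate 2 * 2"
  shows "measure_pmf.prob (coins ([V]\<^bsup>2\<^esup>) p) {f. \<not> pseudorandom q \<epsilon> p V (edge_set V f)}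
     \<le> real ((q + 1) * card V ^ q) * (4 * exp (- c * L))"
proof -
  let ?P = "measure_pmf.prob (coins ([V]\<^bsup>2\<^esup>) p)"
  let ?y = "real (card V) * p ^ q" and ?x = "\<lambda>S. real (card V) * p ^ card S"
  define N where "N S f = common_nbrs V (edge_set V f) S" for S f
  define \<S> where "\<S> = {S. S \<subseteq> V \<and> 2 \<le> card S \<and> card S \<le> q}"
  define T1 where "T1 S = {f. real (card (N S f)) > (1 + \<epsilon>) * ?x S}" for S
  define T2 where "T2 S = {f. real (card (N S f)) < (1 - \<epsilon>)\<^sup>2 * ?x S}" for S
  define T3 where "T3 S = {f. ?y / 2 \<le> real (card (N S f)) \<and> real (card (N S f)) \<le> 2 * ?y \<and>
       \<not> (?y\<^sup>2 * p / 32 \<le> real (card {e \<in> edge_set V f. e \<subseteq> N S f}) \<and>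
         real (card {e \<in> edge_set V f. e \<subseteq> N S f}) \<le> 4 * (?y\<^sup>2 * p))}" for S
  have fin\<S>: "finite \<S>" using V by (simp add: \<S>_def)
  have y0: "?y > 0" using L by linarith
  have edges: "{e \<in> edge_set V f. e \<subseteq> N S f} = edge_set (N S f) f" for S f
    by (auto simp: nsets_def N_def common_nbrs_def)
  have rate: "exp (- r * \<mu>) \<le> exp (- c * L)" if "c \<le> r" "L \<le> \<mu>" for r \<mu>
    using mult_mono[of c r L \<mu>] that L c by simp
  have "{f. \<not> pseudorandom q \<epsilon> p V (edge_set V f)} \<subseteq> (\<Union>S\<in>\<S>. T1 S \<union> T2 S \<union> T3 S)"
  proof
    fix f assume "f \<in> {f. \<not> pseudorandom q \<epsilon> p V (edge_set V f)}"
    then obtain S where S: "S \<in> \<S>" and bad: "\<not> ((1 - \<epsilon>)\<^sup>2 * ?x S \<le> real (card (N S f)) \<and>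
       real (card (N S f)) \<le> (1 + \<epsilon>) * ?x S \<and>
       (card S = q \<longrightarrow> ?y\<^sup>2 * p / 32 \<le> real (card {e \<in> edge_set V f. e \<subseteq> N S f}) \<and>
         real (card {e \<in> edge_set V f. e \<subseteq> N S f}) \<le> 4 * (?y\<^sup>2 * p)))"
      unfolding pseudorandom_def N_def \<S>_def by blast
    have "f \<in> T3 S" if *: "(1 - \<epsilon>)\<^sup>2 * ?x S \<le> real (card (N S f))" "real (card (N S f)) \<le> (1 + \<epsilon>) * ?x S"
    proof -
      have "card S = q" using bad * by blast
      moreover have "1 / 2 * ?y \<le> (1 - \<epsilon>)\<^sup>2 * ?y" "(1 + \<epsilon>) * ?y \<le> 2 * ?y"
        using \<epsilon> y0 by (intro mult_right_mono; simp)+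
      ultimately show ?thesis using bad * unfolding T3_def by auto
    qed
    then show "f \<in> (\<Union>S\<in>\<S>. T1 S \<union> T2 S \<union> T3 S)"
      using S by (force simp: T1_def T2_def)
  qed
  then have "?P {f. \<not> pseudorandom q \<epsilon> p V (edge_set V f)} \<le> ?P (\<Union>S\<in>\<S>. T1 S \<union> T2 S \<union> T3 S)"
    by (intro measure_pmf.finite_measure_mono) auto
  also have "\<dots> \<le> (\<Sum>S\<in>\<S>. ?P (T1 S \<union> T2 S \<union> T3 S))"
    using fin\<S> by (intro measure_pmf.finite_measure_subadditive_finite) auto
  also have "\<dots> \<le> (\<Sum>S\<in>\<S>. 4 * exp (- c * L))"
  proof (rule sum_mono)
    fix S assume "S \<in> \<S>"
    then have S: "S \<subseteq> V" "S \<noteq> {}" "card S \<le> q" by (auto simp: \<S>_def)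
    have "p ^ q \<le> p ^ card S" using p S by (intro power_decreasing) auto
    then have x: "L \<le> ?x S" using L(2) by (meson mult_left_mono of_nat_0_le_iff order_trans)
    have "?P (T1 S) \<le> exp (- chernoff_rate (1 + \<epsilon>) * ?x S)"
      unfolding T1_def N_def by (rule prob_many_common_nbrs[OF V S(1,2) p \<epsilon>(1)])
    also have "\<dots> \<le> exp (- c * L)" by (rule rate[OF c(2) x])
    finally have 1: "?P (T1 S) \<le> exp (- c * L)" .
    have "?P (T2 S) \<le> exp (- chernoff_rate (1 - \<epsilon>) * ((1 - \<epsilon>) * ?x S))"
      unfolding T2_def N_def by (rule prob_few_common_nbrs[OF V S(1,2) p \<epsilon>(1,2)]) (use S n in linarith)
    also have "\<dots> \<le> exp (- c * L)" using rate[OF c(3) x] by (simp add: mult_ac)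
    finally have 2: "?P (T2 S) \<le> exp (- c * L)" .
    have "?P (T3 S) \<le> exp (- chernoff_rate (1/2) * (?y\<^sup>2 * p / 16)) + exp (- chernoff_rate 2 * (2 * (?y\<^sup>2 * p)))"
      unfolding T3_def edges unfolding N_def by (rule prob_edges_within_common_nbrs[OF V S(1,2) p L(1)])
    also have "\<dots> \<le> exp (- c * L) + exp (- c * L)"
      using rate[OF c(4) L(3)] rate[OF c(5) L(3)] by (intro add_mono) (simp_all add: mult_ac)
    finally have 3: "?P (T3 S) \<le> 2 * exp (- c * L)" by simp
    have "?P (T1 S \<union> T2 S \<union> T3 S) \<le> ?P (T1 S) + ?P (T2 S) + ?P (T3 S)"
      by (intro order_trans[OF measure_Un_le] add_mono measure_Un_le) auto
    then show "?P (T1 S \<union> T2 S \<union> T3 S) \<le> 4 * exp (- c * L)" using 1 2 3 by linarith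
  qed
  also have "\<dots> = real (card \<S>) * (4 * exp (- c * L))" by simp
  also have "\<dots> \<le> real ((q + 1) * card V ^ q) * (4 * exp (- c * L))"
  proof (intro mult_right_mono)
    have "card V > 0" using y0 by (auto intro: gr0I)
    from card_small_subsets_le[OF V this, of q]
    show "real (card \<S>) \<le> real ((q + 1) * card V ^ q)" unfolding \<S>_def of_nat_le_iff .
  qed simp
  finally show ?thesis .
qed

text \<open>
  The ratio of the two constants in \<open>pseudorandom\<close> is \<open>128\<close>. Hence
  \<open>fractional_clique_decomposition_of_pseudorandom\<close> applies when the relative error \<open>\<eta>\<close> of the clique numbers
  is at most \<open>\<kappa>/(256 C)\<close> and \<open>a ^ (q - 2) \<ge> 1/2\<close> for \<open>a = (1 - \<epsilon>)\<^sup>2\<close>. Both hold for small \<open>\<epsilon>\<close> by continuity.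
\<close>
lemma ex_pseudorandom_accuracy:
  assumes "q \<ge> 2"
  obtains \<epsilon> where "0 < \<epsilon>" "\<epsilon> < 1" "1 / 2 \<le> (1 - \<epsilon>)\<^sup>2"
    "\<And>p V E. finite V \<Longrightarrow> V \<noteq> {} \<Longrightarrow> E \<subseteq> [V]\<^bsup>2\<^esup> \<Longrightarrow> 0 < p \<Longrightarrow> pseudorandom q \<epsilon> p V E
       \<Longrightarrow> \<exists>\<psi>. fractional_clique_decomposition q (V :: 'a set) E \<psi>"
proof -
  define \<kappa> where "\<kappa> = (\<Prod>i=2..<q. real (q - i) / real (q + 2 - i))"
  define C where "C = real ((q + 2) choose 2)"
  define \<eta> where "\<eta> = min (1 / 2) (\<kappa> / (256 * C))"
  have \<kappa>: "\<kappa> > 0" unfolding \<kappa>_def by (intro prod_pos) auto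
  have C: "C > 0" unfolding C_def by simp
  have \<eta>: "\<eta> > 0" "\<eta> \<le> 1 / 2" using \<kappa> C by (auto simp: \<eta>_def)
  have C\<eta>: "256 * (C * \<eta>) \<le> \<kappa>" using C by (simp add: \<eta>_def min_def field_simps)
  have "((\<lambda>\<epsilon>. ((1 - \<epsilon>)\<^sup>2) ^ (q - 2)) \<longlongrightarrow> ((1 - 0)\<^sup>2) ^ (q - 2)) (at_right (0::real))"
    by (intro tendsto_intros)
  then have "\<forall>\<^sub>F \<epsilon> in at_right (0::real). 1 - \<eta> < ((1 - \<epsilon>)\<^sup>2) ^ (q - 2)"
    using \<eta> by (intro order_tendstoD(1)) auto
  moreover have "((\<lambda>\<epsilon>. (1 - \<epsilon>)\<^sup>2) \<longlongrightarrow> (1 - 0)\<^sup>2) (at_right (0::real))"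
    by (intro tendsto_intros)
  then have "\<forall>\<^sub>F \<epsilon> in at_right (0::real). 1 / 2 < (1 - \<epsilon>)\<^sup>2"
    by (intro order_tendstoD(1)) auto
  moreover have "((\<lambda>\<epsilon>. (1 + \<epsilon>) ^ (q - 2)) \<longlongrightarrow> (1 + 0) ^ (q - 2)) (at_right (0::real))"
    by (intro tendsto_intros)
  then have "\<forall>\<^sub>F \<epsilon> in at_right (0::real). (1 + \<epsilon>) ^ (q - 2) < 1 + \<eta>"
    using \<eta> by (intro order_tendstoD(2)) auto
  moreover have "\<forall>\<^sub>F \<epsilon> in at_right (0::real). \<epsilon> \<in> {0<..<1}"
    by (rule eventually_at_right_real) simp
  ultimately have "\<forall>\<^sub>F \<epsilon> in at_right (0::real). 1 - \<eta> < ((1 - \<epsilon>)\<^sup>2) ^ (q - 2) \<and> 1 / 2 < (1 - \<epsilon>)\<^sup>2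
      \<and> (1 + \<epsilon>) ^ (q - 2) < 1 + \<eta> \<and> \<epsilon> \<in> {0<..<1}"
    by eventually_elim auto
  then obtain \<epsilon> where \<epsilon>: "1 - \<eta> < ((1 - \<epsilon>)\<^sup>2) ^ (q - 2)" "1 / 2 < (1 - \<epsilon>)\<^sup>2"
      "(1 + \<epsilon>) ^ (q - 2) < 1 + \<eta>" "0 < \<epsilon>" "\<epsilon> < 1"
    using eventually_happens'[OF trivial_limit_at_right_real] by fastforce
  show ?thesis
  proof (rule that[of \<epsilon>])
    fix p :: real and V :: "'a set" and E
    assume V: "finite V" "V \<noteq> {}" and E: "E \<subseteq> [V]\<^bsup>2\<^esup>" and p: "0 < p" and ps: "pseudorandom q \<epsilon> p V E"
    let ?Y = "(real (card V) * p ^ q)\<^sup>2 * p"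
    have n: "card V > 0" using V by (simp add: card_gt_0_iff)
    have S: "S \<subseteq> V \<and> card S = i" if "S \<in> cliques i V E" for S i
      using that by (auto simp: cliques_def nsets_def)
    show "\<exists>\<psi>. fractional_clique_decomposition q V E \<psi>"
    proof (rule fractional_clique_decomposition_of_pseudorandom[OF V(1) E assms,
          of "\<lambda>i. real (card V) * p ^ i" "(1 - \<epsilon>)\<^sup>2" "1 + \<epsilon>" "?Y / 32" "4 * ?Y" \<eta>])
      have "128 * (C * \<eta>) \<le> ((1 - \<epsilon>)\<^sup>2) ^ (q - 2) * \<kappa>"
        using mult_right_mono[of "1 / 2" "((1 - \<epsilon>)\<^sup>2) ^ (q - 2)" \<kappa>] \<epsilon>(1) \<eta> C\<eta> \<kappa> by linarith
      then have "?Y / 32 * (128 * (C * \<eta>)) \<le> ?Y / 32 * (((1 - \<epsilon>)\<^sup>2) ^ (q - 2) * \<kappa>)"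
        using p by (intro mult_left_mono) auto
      then show "4 * ?Y * real ((q + 2) choose 2) * \<eta> \<le> ?Y / 32 * ((1 - \<epsilon>)\<^sup>2) ^ (q - 2)
          * (\<Prod>i=2..<q. real (q - i) / real (q + 2 - i))"
        unfolding C_def \<kappa>_def by (simp only: mult_ac) simp
      show "?Y / 32 \<le> real (card {e \<in> E. e \<subseteq> common_nbrs V E S}) \<and>
          real (card {e \<in> E. e \<subseteq> common_nbrs V E S}) \<le> 4 * ?Y" if "S \<in> cliques q V E" for S
        using ps S[OF that] assms unfolding pseudorandom_def by blast
      show "(1 - \<epsilon>)\<^sup>2 * (real (card V) * p ^ i) \<le> real (card (common_nbrs V E S)) \<and>
          real (card (common_nbrs V E S)) \<le> (1 + \<epsilon>) * (real (card V) * p ^ i)"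
        if "2 \<le> i" "i < q" "S \<in> cliques i V E" for i S
        using ps S[OF that(3)] that(1,2) unfolding pseudorandom_def by (metis less_imp_le)
    qed (use \<epsilon> \<eta> p n in auto)
  qed (use \<epsilon> in auto)
qed

section \<open>The random graph\<close>

theorem theorem1p18:
  fixes q :: nat and \<beta> :: real and p :: "nat \<Rightarrow> real"
  assumes "q \<ge> 4" and "\<beta> > 0"
    and "\<And>n. n \<ge> 1 \<Longrightarrow> 0 \<le> p n \<and> p n \<le> 1"
    and "\<And>n. n \<ge> 1 \<Longrightarrow> p n \<ge> real n powr (- (1 / (real q + 1 / 2)) + \<beta>)"
  shows "(\<lambda>n. measure_pmf.prob (gnp n (p n))
            {E. \<exists>\<psi>. fractional_clique_decomposition q {1..n} E \<psi>}) \<longlonglongrightarrow> 1"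
proof -
  have q2: "q \<ge> 2" using assms(1) by simp
  obtain \<epsilon> :: real where \<epsilon>: "0 < \<epsilon>" "\<epsilon> < 1" "1 / 2 \<le> (1 - \<epsilon>)\<^sup>2"
    and decomp: "\<And>p V E. finite V \<Longrightarrow> V \<noteq> {} \<Longrightarrow> E \<subseteq> [V]\<^bsup>2\<^esup> \<Longrightarrow> 0 < p \<Longrightarrow> pseudorandom q \<epsilon> p V E
       \<Longrightarrow> \<exists>\<psi>. fractional_clique_decomposition q (V :: nat set) E \<psi>"
    using ex_pseudorandom_accuracy[OF q2, where 'a = nat] by metis
  define c where "c = Min {chernoff_rate (1 + \<epsilon>), chernoff_rate (1 - \<epsilon>) * (1 - \<epsilon>),
      chernoff_rate (1/2) / 16, chernoff_rate 2 * 2}"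
  have c: "0 < c" "c \<le> chernoff_rate (1 + \<epsilon>)" "c \<le> chernoff_rate (1 - \<epsilon>) * (1 - \<epsilon>)"
      "c \<le> chernoff_rate (1/2) / 16" "c \<le> chernoff_rate 2 * 2"
    unfolding c_def using \<epsilon> by (auto intro!: chernoff_rate_pos mult_pos_pos)
  let ?prob = "\<lambda>n. measure_pmf.prob (gnp n (p n)) {E. \<exists>\<psi>. fractional_clique_decomposition q {1..n} E \<psi>}"
  let ?err = "\<lambda>n::nat. real (q + 1) * real n powr real q * (4 * exp (- c * real n powr \<beta>))"
  have lower: "1 - ?err n \<le> ?prob n" if n: "n \<ge> 1" "real q \<le> \<epsilon> * real n" "4 \<le> real n powr \<beta>" for n
  proof -
    let ?V = "{1..n}" and ?x = "real n powr (- (1 / (real q + 1 / 2)) + \<beta>)"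
    let ?P = "measure_pmf.prob (coins ([?V]\<^bsup>2\<^esup>) (p n))"
    let ?bad = "{f. \<not> pseudorandom q \<epsilon> (p n) ?V (edge_set ?V f)}"
    have p: "0 \<le> p n" "p n \<le> 1" "?x \<le> p n" using assms(3,4) n by auto
    have x: "?x > 0" using n by simp
    have "real n powr \<beta> \<le> real n powr (1 + real q * (- (1 / (real q + 1 / 2)) + \<beta>))"
    proof (rule powr_mono)
      have "\<beta> * 1 \<le> \<beta> * real q" using assms(1,2) by (intro mult_left_mono) auto
      moreover have "real q / (real q + 1 / 2) \<le> 1" by (simp add: field_simps)
      moreover have "real q * (- (1 / (real q + 1 / 2)) + \<beta>) = \<beta> * real q - real q / (real q + 1 / 2)"
        by (simp add: right_diff_distrib mult.commute)
      ultimately show "\<beta> \<le> 1 + real q * (- (1 / (real q + 1 / 2)) + \<beta>)" by linarith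
    qed (use n in simp)
    also have "\<dots> = real n * ?x ^ q"
      using n by (simp add: powr_add powr_powr mult_ac flip: powr_realpow)
    also have "\<dots> \<le> real n * p n ^ q" using p x by (intro mult_left_mono power_mono) auto
    finally have L1: "real n powr \<beta> \<le> real n * p n ^ q" .
    \<comment> \<open>The exponent \<open>1/(q+1/2)\<close> makes the first two summands cancel: \<open>2 - (2q+1)/(q+1/2) = 0\<close>.\<close>
    have "real n powr \<beta> \<le> real n powr (2 + real (2 * q + 1) * (- (1 / (real q + 1 / 2)) + \<beta>))"
    proof (rule powr_mono)
      have "\<beta> * 1 \<le> \<beta> * real (2 * q + 1)" using assms(1,2) by (intro mult_left_mono) auto
      moreover have "real (2 * q + 1) / (real q + 1 / 2) = 2" by (simp add: field_simps)
      ultimately show "\<beta> \<le> 2 + real (2 * q + 1) * (- (1 / (real q + 1 / 2)) + \<beta>)"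
        by (simp only: distrib_left mult_minus_right times_divide_eq_right mult_1_right) (simp add: mult.commute)
    qed (use n in simp)
    also have "\<dots> = real n powr 2 * (real n powr (- (1 / (real q + 1 / 2)) + \<beta>)) powr real (2 * q + 1)"
      by (simp only: powr_add[of _ 2] powr_powr mult.commute)
    also have "\<dots> = (real n)\<^sup>2 * ?x ^ (2 * q + 1)"
      using n x by (simp only: powr_realpow) (simp add: powr_numeral)
    also have "\<dots> \<le> (real n)\<^sup>2 * p n ^ (2 * q + 1)" using p x by (intro mult_left_mono power_mono) auto
    also have "\<dots> = (real n * p n ^ q)\<^sup>2 * p n"
      by (simp add: power_mult_distrib power_mult[symmetric] mult.commute)
    finally have L2: "real n powr \<beta> \<le> (real n * p n ^ q)\<^sup>2 * p n" .
    have "?P ?bad \<le> real ((q + 1) * card ?V ^ q) * (4 * exp (- c * real n powr \<beta>))"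
      by (rule prob_not_pseudorandom[OF _ p(1,2) q2 \<epsilon> _ _ _ _ _ c]) (use n L1 L2 in auto)
    then have bad: "?P ?bad \<le> ?err n"
      using n by (simp only: of_nat_mult of_nat_power card_atLeastAtMost) (simp add: powr_realpow)
    have "1 - ?P ?bad = ?P (UNIV - ?bad)"
      using measure_pmf.prob_compl[of ?bad "coins ([?V]\<^bsup>2\<^esup>) (p n)"] by simp
    also have "\<dots> \<le> ?P {f. \<exists>\<psi>. fractional_clique_decomposition q ?V (edge_set ?V f) \<psi>}"
    proof (rule measure_pmf.finite_measure_mono)
      have "0 < p n" using p x by linarith
      then show "UNIV - ?bad \<subseteq> {f. \<exists>\<psi>. fractional_clique_decomposition q ?V (edge_set ?V f) \<psi>}"
        using n by (auto intro!: decomp)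
    qed simp
    also have "\<dots> = ?prob n" by (simp add: gnp_def vimage_def)
    finally show ?thesis using bad by linarith
  qed
  have "\<forall>\<^sub>F n in sequentially. real q \<le> \<epsilon> * real n" using \<epsilon> by real_asymp
  moreover have "\<forall>\<^sub>F n in sequentially. 4 \<le> real n powr \<beta>" using assms(2) by real_asymp
  ultimately have ev: "\<forall>\<^sub>F n in sequentially. 1 - ?err n \<le> ?prob n"
    using eventually_ge_at_top[of 1] by eventually_elim (rule lower)
  have err: "?err \<longlonglongrightarrow> 0" using c(1) assms(2) by real_asymp
  have lim: "(\<lambda>n. 1 - ?err n) \<longlonglongrightarrow> 1"
    using tendsto_diff[OF tendsto_const err, of 1] by (simp only: diff_0_right)
  show ?thesis
    by (rule tendsto_sandwich[OF ev _ lim tendsto_const]) simp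
qed

end
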